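(* Let $\Omega$ be a semigroup with unit $1$ and let $(A,\mu,N)$ be a Nijenhuis family $\Omega$-associative algebra. If $(A[\![t]\!],\mu_t,N_t)$ and $(A[\![t]\!],\mu'_t,N'_t)$ are two equivalent one-parameter formal deformations of $(A,\mu,N)$, then their infinitesimals $(\mu_1,N_1)$ and $(\mu'_1,N'_1)$ are in the same cohomology class in $\mathrm{H}^2_{\mathrm{NFA}}(A)$.
   Context: All vector spaces are over a field $\mathbf{k}$. An $\Omega$-associative algebra is a vector space $A$ with bilinear operations $\mu_{\alpha,\beta}:A\otimes A\to A$, $a\otimes b\mapsto a\cdot_{\alpha,\beta}b$ ($\alpha,\beta\in\Omega$), such that $(a\cdot_{\alpha,\beta}b)\cdot_{\alpha\beta,\gamma}c=a\cdot_{\alpha,\beta\gamma}(b\cdot_{\beta,\gamma}c)$. A Nijenhuis family $\Omega$-associative algebra $(A,\mu,N)$ is an $\Omega$-associative algebra with linear maps $N_\omega:A\to A$ ($\omega\in\Omega$) such that $N_\alpha(a)\cdot_{\alpha,\beta}N_\beta(b)=N_{\alpha\beta}\big(N_\alpha(a)\cdot_{\alpha,\beta}b+a\cdot_{\alpha,\beta}N_\beta(b)-N_{\alpha\beta}(a\cdot_{\alpha,\beta}b)\big)$. A one-parameter formal deformation of $(A,\mu,N)$ is a pair $\mu_t=\sum_{i\ge0}\mu_it^i$, $N_t=\sum_{i\ge0}N_it^i$, where $\mu_i=\{\mu_{i,\alpha,\beta}\}_{\alpha,\beta\in\Omega}$ is a family of linear maps $A\otimes A\to A$, $N_i=\{N_{i,\omega}\}_{\omega\in\Omega}$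 a family of linear maps $A\to A$, $\mu_0=\mu$, $N_0=N$, such that $(A[\![t]\!],\mu_t,N_t)$ (with $\mu_t,N_t$ extended $\mathbf{k}[\![t]\!]$-(bi)linearly) is a Nijenhuis family $\Omega$-associative algebra over $\mathbf{k}[\![t]\!]$. Its infinitesimal is $(\mu_1,N_1)$. Two deformations $(\mu_t,N_t)$, $(\mu'_t,N'_t)$ are equivalent if there is a family $\psi_t=\{\psi_{t,\theta}\}_{\theta\in\Omega}$, $\psi_{t,\theta}=\sum_{i\ge0}\psi_{i,\theta}t^i$, with $\psi_{i,\theta}:A\to A$ linear and $\psi_{0,\theta}=\mathrm{id}_A$, such that $\psi_{t,\alpha\beta}\circ\mu'_{t,\alpha,\beta}=\mu_{t,\alpha,\beta}\circ(\psi_{t,\alpha}\otimes\psi_{t,\beta})$ and $\psi_{t,\omega}\circ N'_{t,\omega}=N_{t,\omega}\circ\psi_{t,\omega}$ for all $\alpha,\beta,\omega\in\Omega$. Cohomology: $\mathrm{H}^2_{\mathrm{NFA}}(A)=\ker d^2/\operatorname{im}d^1$. Here $C^1_{\mathrm{NFA}}(A)$ consists of pairs $(f,m)$ with $f=\{f_\alpha\}$ a family of linear maps $A\to A$ and $m\in A$; $C^2_{\mathrm{NFA}}(A)$ consists of pairs $(f,g)$ with $f=\{f_{\alpha,\beta}\}$ a family of linear maps $A^{\otimes2}\to A$ and $g=\{g_\alpha\}$ a family of linear maps $A\to A$; $d^1(f,m)=(\delta^1(f),-\partial^0(m)-\Phi^1(f))$ and $d^2(f,g)=(\delta^2(f),-\partial^1(g)-\Phi^2(f))$,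 where $\delta^1(f)_{\alpha,\beta}(a,b)=a\cdot_{\alpha,\beta}f_\beta(b)-f_{\alpha\beta}(a\cdot_{\alpha,\beta}b)+f_\alpha(a)\cdot_{\alpha,\beta}b$; $\delta^2(f)_{\alpha,\beta,\gamma}(a,b,c)=-a\cdot_{\alpha,\beta\gamma}f_{\beta,\gamma}(b,c)+f_{\alpha\beta,\gamma}(a\cdot_{\alpha,\beta}b,c)-f_{\alpha,\beta\gamma}(a,b\cdot_{\beta,\gamma}c)+f_{\alpha,\beta}(a,b)\cdot_{\alpha\beta,\gamma}c$; $\partial^0(m)_\alpha(a)=N_\alpha(a)\cdot_{\alpha,1}m-m\cdot_{1,\alpha}N_\alpha(a)-N_\alpha(a\cdot_{\alpha,1}m-m\cdot_{1,\alpha}a)$; $\partial^1(g)_{\alpha,\beta}(a,b)=N_\alpha(a)\cdot_{\alpha,\beta}g_\beta(b)-N_{\alpha\beta}(a\cdot_{\alpha,\beta}g_\beta(b))-g_{\alpha\beta}\big(N_\alpha(a)\cdot_{\alpha,\beta}b+a\cdot_{\alpha,\beta}N_\beta(b)-N_{\alpha\beta}(a\cdot_{\alpha,\beta}b)\big)+g_\alpha(a)\cdot_{\alpha,\beta}N_\beta(b)-N_{\alpha\beta}(g_\alpha(a)\cdot_{\alpha,\beta}b)$; $\Phi^1(f)_\alpha(a)=f_\alpha(N_\alpha(a))-N_\alpha(f_\alpha(a))$; $\Phi^2(f)_{\alpha,\beta}(a,b)=f_{\alpha,\beta}(N_\alpha(a),N_\beta(b))-N_{\alpha\beta}f_{\alpha,\beta}(N_\alpha(a),b)-N_{\alpha\beta}f_{\alpha,\beta}(a,N_\beta(b))+N_{\alpha\beta}^2f_{\alpha,\beta}(a,b)$.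 Two elements are in the same cohomology class if their difference lies in $\operatorname{im}d^1$.
   Formalization: With the given ∂^1 (which lacks the term N_{αβ}(g_{αβ}(a·b))) infinitesimals need not lie in ker d^2, so their classes in H^2 may be undefined; the formal claim is that both lie in C^2_NFA and their difference lies in im d^1, without membership in ker d^2. *)

theory Defs
  imports
    "HOL-Library.Function_Algebras"
    "HOL-Library.Product_Plus"
    "HOL-Computational_Algebra.Formal_Power_Series"
begin

text \<open>
  Linear maps \<open>A \<otimes> A \<rightarrow> A\<close> are represented by curried bilinear maps \<open>A \<Rightarrow> A \<Rightarrow> A\<close>.
  Scalars range over a commutative ring, so that the same notions apply over a field \<open>k\<close>
  and over \<open>k[[t]]\<close>.
\<close>

definition bilinear_map :: "('r::comm_ring_1 \<Rightarrow> 'a::ab_group_add \<Rightarrow> 'a) \<Rightarrow> ('a \<Rightarrow> 'a \<Rightarrow> 'a) \<Rightarrow> bool" where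
  "bilinear_map scale f \<longleftrightarrow>
     (\<forall>a. module_hom scale scale (\<lambda>b. f a b)) \<and> (\<forall>b. module_hom scale scale (\<lambda>a. f a b))"

locale omega_associative_algebra = module scale
  for scale :: "'r::comm_ring_1 \<Rightarrow> 'a::ab_group_add \<Rightarrow> 'a" +
  fixes mu :: "'o::monoid_mult \<Rightarrow> 'o \<Rightarrow> 'a \<Rightarrow> 'a \<Rightarrow> 'a"
  assumes bilinear_mu: "bilinear_map scale (mu \<alpha> \<beta>)"
    and assoc_mu: "mu (\<alpha> * \<beta>) \<gamma> (mu \<alpha> \<beta> a b) c = mu \<alpha> (\<beta> * \<gamma>) a (mu \<beta> \<gamma> b c)"

locale nijenhuis_family_algebra = omega_associative_algebra scale mu
  for scale :: "'r::comm_ring_1 \<Rightarrow> 'a::ab_group_add \<Rightarrow> 'a"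
    and mu :: "'o::monoid_mult \<Rightarrow> 'o \<Rightarrow> 'a \<Rightarrow> 'a \<Rightarrow> 'a" +
  fixes N :: "'o \<Rightarrow> 'a \<Rightarrow> 'a"
  assumes linear_N: "module_hom scale scale (N \<omega>)"
    and nijenhuis: "mu \<alpha> \<beta> (N \<alpha> a) (N \<beta> b) =
      N (\<alpha> * \<beta>) (mu \<alpha> \<beta> (N \<alpha> a) b + mu \<alpha> \<beta> a (N \<beta> b) - N (\<alpha> * \<beta>) (mu \<alpha> \<beta> a b))"


section \<open>Formal deformations\<close>

text \<open>
  The \<open>k[[t]]\<close>-module \<open>A[[t]]\<close> is the type \<^typ>\<open>'a fps\<close> with the scalar action \<open>fps_scale\<close>.
  A power series of linear or bilinear maps on \<open>A\<close> is extended to \<open>A[[t]]\<close> by the Cauchy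
  product; when \<open>A\<close> is infinite-dimensional, this is the \<open>t\<close>-adically continuous extension.
\<close>

definition fps_scale :: "('k::field \<Rightarrow> 'a::ab_group_add \<Rightarrow> 'a) \<Rightarrow> 'k fps \<Rightarrow> 'a fps \<Rightarrow> 'a fps" where
  "fps_scale scale c x = Abs_fps (\<lambda>n. \<Sum>i\<le>n. scale (fps_nth c i) (fps_nth x (n - i)))"

definition fps_extend :: "(nat \<Rightarrow> 'a::ab_group_add \<Rightarrow> 'a) \<Rightarrow> 'a fps \<Rightarrow> 'a fps" where
  "fps_extend f x = Abs_fps (\<lambda>n. \<Sum>i\<le>n. f i (fps_nth x (n - i)))"

definition fps_extend2 :: "(nat \<Rightarrow> 'a::ab_group_add \<Rightarrow> 'a \<Rightarrow> 'a) \<Rightarrow> 'a fps \<Rightarrow> 'a fps \<Rightarrow> 'a fps" where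
  "fps_extend2 f x y =
     Abs_fps (\<lambda>n. \<Sum>i\<le>n. \<Sum>j\<le>n - i. f i (fps_nth x j) (fps_nth y (n - i - j)))"

definition fam_extend :: "(nat \<Rightarrow> 'o \<Rightarrow> 'a::ab_group_add \<Rightarrow> 'a) \<Rightarrow> 'o \<Rightarrow> 'a fps \<Rightarrow> 'a fps" where
  "fam_extend f \<omega> = fps_extend (\<lambda>i. f i \<omega>)"

definition fam_extend2 ::
    "(nat \<Rightarrow> 'o \<Rightarrow> 'o \<Rightarrow> 'a::ab_group_add \<Rightarrow> 'a \<Rightarrow> 'a) \<Rightarrow> 'o \<Rightarrow> 'o \<Rightarrow> 'a fps \<Rightarrow> 'a fps \<Rightarrow> 'a fps" where
  "fam_extend2 f \<alpha> \<beta> = fps_extend2 (\<lambda>i. f i \<alpha> \<beta>)"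

text \<open>\<open>mut i \<alpha> \<beta>\<close> and \<open>Nt i \<omega>\<close> are the coefficients of \<open>t^i\<close> in \<open>\<mu>\<^sub>t\<close> and \<open>N\<^sub>t\<close>.\<close>

definition formal_deformation ::
    "('k::field \<Rightarrow> 'a::ab_group_add \<Rightarrow> 'a) \<Rightarrow>
     ('o::monoid_mult \<Rightarrow> 'o \<Rightarrow> 'a \<Rightarrow> 'a \<Rightarrow> 'a) \<Rightarrow> ('o \<Rightarrow> 'a \<Rightarrow> 'a) \<Rightarrow>
     (nat \<Rightarrow> 'o \<Rightarrow> 'o \<Rightarrow> 'a \<Rightarrow> 'a \<Rightarrow> 'a) \<Rightarrow> (nat \<Rightarrow> 'o \<Rightarrow> 'a \<Rightarrow> 'a) \<Rightarrow> bool" where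
  "formal_deformation scale mu N mut Nt \<longleftrightarrow>
     (\<forall>i \<alpha> \<beta>. bilinear_map scale (mut i \<alpha> \<beta>)) \<and>
     (\<forall>i \<omega>. module_hom scale scale (Nt i \<omega>)) \<and>
     mut 0 = mu \<and> Nt 0 = N \<and>
     nijenhuis_family_algebra (fps_scale scale) (fam_extend2 mut) (fam_extend Nt)"

definition infinitesimal ::
    "(nat \<Rightarrow> 'o \<Rightarrow> 'o \<Rightarrow> 'a \<Rightarrow> 'a \<Rightarrow> 'a) \<Rightarrow> (nat \<Rightarrow> 'o \<Rightarrow> 'a \<Rightarrow> 'a) \<Rightarrow>
     ('o \<Rightarrow> 'o \<Rightarrow> 'a \<Rightarrow> 'a \<Rightarrow> 'a) \<times> ('o \<Rightarrow> 'a \<Rightarrow> 'a)" where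
  "infinitesimal mut Nt = (mut 1, Nt 1)"

definition equivalent_deformations ::
    "('k::field \<Rightarrow> 'a::ab_group_add \<Rightarrow> 'a) \<Rightarrow>
     (nat \<Rightarrow> 'o::monoid_mult \<Rightarrow> 'o \<Rightarrow> 'a \<Rightarrow> 'a \<Rightarrow> 'a) \<Rightarrow> (nat \<Rightarrow> 'o \<Rightarrow> 'a \<Rightarrow> 'a) \<Rightarrow>
     (nat \<Rightarrow> 'o \<Rightarrow> 'o \<Rightarrow> 'a \<Rightarrow> 'a \<Rightarrow> 'a) \<Rightarrow> (nat \<Rightarrow> 'o \<Rightarrow> 'a \<Rightarrow> 'a) \<Rightarrow> bool" where
  "equivalent_deformations scale mut Nt mut' Nt' \<longleftrightarrow>
     (\<exists>\<psi> :: nat \<Rightarrow> 'o \<Rightarrow> 'a \<Rightarrow> 'a.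
        (\<forall>i \<theta>. module_hom scale scale (\<psi> i \<theta>)) \<and> (\<forall>\<theta>. \<psi> 0 \<theta> = id) \<and>
        (\<forall>\<alpha> \<beta> x y. fam_extend \<psi> (\<alpha> * \<beta>) (fam_extend2 mut' \<alpha> \<beta> x y) =
                    fam_extend2 mut \<alpha> \<beta> (fam_extend \<psi> \<alpha> x) (fam_extend \<psi> \<beta> y)) \<and>
        (\<forall>\<omega> x. fam_extend \<psi> \<omega> (fam_extend Nt' \<omega> x) = fam_extend Nt \<omega> (fam_extend \<psi> \<omega> x)))"


section \<open>Cohomology\<close>

definition C1 :: "('k::field \<Rightarrow> 'a::ab_group_add \<Rightarrow> 'a) \<Rightarrow> (('o \<Rightarrow> 'a \<Rightarrow> 'a) \<times> 'a) set" where
  "C1 scale = {(f, m). \<forall>\<alpha>. module_hom scale scale (f \<alpha>)}"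

definition C2 :: "('k::field \<Rightarrow> 'a::ab_group_add \<Rightarrow> 'a) \<Rightarrow>
    (('o \<Rightarrow> 'o \<Rightarrow> 'a \<Rightarrow> 'a \<Rightarrow> 'a) \<times> ('o \<Rightarrow> 'a \<Rightarrow> 'a)) set" where
  "C2 scale = {(f, g). (\<forall>\<alpha> \<beta>. bilinear_map scale (f \<alpha> \<beta>)) \<and> (\<forall>\<alpha>. module_hom scale scale (g \<alpha>))}"

context
  fixes mu :: "'o::monoid_mult \<Rightarrow> 'o \<Rightarrow> 'a::ab_group_add \<Rightarrow> 'a \<Rightarrow> 'a"
    and N :: "'o \<Rightarrow> 'a \<Rightarrow> 'a"
begin

definition delta1 :: "('o \<Rightarrow> 'a \<Rightarrow> 'a) \<Rightarrow> 'o \<Rightarrow> 'o \<Rightarrow> 'a \<Rightarrow> 'a \<Rightarrow> 'a" where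
  "delta1 f \<alpha> \<beta> a b = mu \<alpha> \<beta> a (f \<beta> b) - f (\<alpha> * \<beta>) (mu \<alpha> \<beta> a b) + mu \<alpha> \<beta> (f \<alpha> a) b"

definition delta2 ::
    "('o \<Rightarrow> 'o \<Rightarrow> 'a \<Rightarrow> 'a \<Rightarrow> 'a) \<Rightarrow> 'o \<Rightarrow> 'o \<Rightarrow> 'o \<Rightarrow> 'a \<Rightarrow> 'a \<Rightarrow> 'a \<Rightarrow> 'a" where
  "delta2 f \<alpha> \<beta> \<gamma> a b c =
     - mu \<alpha> (\<beta> * \<gamma>) a (f \<beta> \<gamma> b c) + f (\<alpha> * \<beta>) \<gamma> (mu \<alpha> \<beta> a b) c
     - f \<alpha> (\<beta> * \<gamma>) a (mu \<beta> \<gamma> b c) + mu (\<alpha> * \<beta>) \<gamma> (f \<alpha> \<beta> a b) c"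

definition partial0 :: "'a \<Rightarrow> 'o \<Rightarrow> 'a \<Rightarrow> 'a" where
  "partial0 m \<alpha> a =
     mu \<alpha> 1 (N \<alpha> a) m - mu 1 \<alpha> m (N \<alpha> a) - N \<alpha> (mu \<alpha> 1 a m - mu 1 \<alpha> m a)"

definition partial1 :: "('o \<Rightarrow> 'a \<Rightarrow> 'a) \<Rightarrow> 'o \<Rightarrow> 'o \<Rightarrow> 'a \<Rightarrow> 'a \<Rightarrow> 'a" where
  "partial1 g \<alpha> \<beta> a b =
     mu \<alpha> \<beta> (N \<alpha> a) (g \<beta> b) - N (\<alpha> * \<beta>) (mu \<alpha> \<beta> a (g \<beta> b))
     - g (\<alpha> * \<beta>) (mu \<alpha> \<beta> (N \<alpha> a) b + mu \<alpha> \<beta> a (N \<beta> b) - N (\<alpha> * \<beta>) (mu \<alpha> \<beta> a b))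
     + mu \<alpha> \<beta> (g \<alpha> a) (N \<beta> b) - N (\<alpha> * \<beta>) (mu \<alpha> \<beta> (g \<alpha> a) b)"

definition Phi1 :: "('o \<Rightarrow> 'a \<Rightarrow> 'a) \<Rightarrow> 'o \<Rightarrow> 'a \<Rightarrow> 'a" where
  "Phi1 f \<alpha> a = f \<alpha> (N \<alpha> a) - N \<alpha> (f \<alpha> a)"

definition Phi2 :: "('o \<Rightarrow> 'o \<Rightarrow> 'a \<Rightarrow> 'a \<Rightarrow> 'a) \<Rightarrow> 'o \<Rightarrow> 'o \<Rightarrow> 'a \<Rightarrow> 'a \<Rightarrow> 'a" where
  "Phi2 f \<alpha> \<beta> a b =
     f \<alpha> \<beta> (N \<alpha> a) (N \<beta> b) - N (\<alpha> * \<beta>) (f \<alpha> \<beta> (N \<alpha> a) b)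
     - N (\<alpha> * \<beta>) (f \<alpha> \<beta> a (N \<beta> b)) + N (\<alpha> * \<beta>) (N (\<alpha> * \<beta>) (f \<alpha> \<beta> a b))"

definition d1 ::
    "('o \<Rightarrow> 'a \<Rightarrow> 'a) \<times> 'a \<Rightarrow> ('o \<Rightarrow> 'o \<Rightarrow> 'a \<Rightarrow> 'a \<Rightarrow> 'a) \<times> ('o \<Rightarrow> 'a \<Rightarrow> 'a)" where
  "d1 = (\<lambda>(f, m). (delta1 f, \<lambda>\<alpha> a. - partial0 m \<alpha> a - Phi1 f \<alpha> a))"

definition d2 ::
    "('o \<Rightarrow> 'o \<Rightarrow> 'a \<Rightarrow> 'a \<Rightarrow> 'a) \<times> ('o \<Rightarrow> 'a \<Rightarrow> 'a) \<Rightarrow>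
     ('o \<Rightarrow> 'o \<Rightarrow> 'o \<Rightarrow> 'a \<Rightarrow> 'a \<Rightarrow> 'a \<Rightarrow> 'a) \<times> ('o \<Rightarrow> 'o \<Rightarrow> 'a \<Rightarrow> 'a \<Rightarrow> 'a)" where
  "d2 = (\<lambda>(f, g). (delta2 f, \<lambda>\<alpha> \<beta> a b. - partial1 g \<alpha> \<beta> a b - Phi2 f \<alpha> \<beta> a b))"

text \<open>
  Two 2-cochains are cohomologous if their (pointwise) difference lies in the image of \<open>d1\<close>.
  The relation is taken on all of \<open>C2\<close>, not just on the kernel of \<open>d2\<close>: with \<open>partial1\<close> as
  above, neither coboundaries nor infinitesimals are annihilated by \<open>d2\<close> in general.
  The linearisation of the Nijenhuis identity has the additional term
  \<open>N (\<alpha> * \<beta>) (g (\<alpha> * \<beta>) (mu \<alpha> \<beta> a b))\<close> besides \<open>partial1 g + Phi2 f\<close>.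
\<close>

definition cohomologous ::
    "('k::field \<Rightarrow> 'a \<Rightarrow> 'a) \<Rightarrow> ((('o \<Rightarrow> 'o \<Rightarrow> 'a \<Rightarrow> 'a \<Rightarrow> 'a) \<times> ('o \<Rightarrow> 'a \<Rightarrow> 'a)) \<times>
      (('o \<Rightarrow> 'o \<Rightarrow> 'a \<Rightarrow> 'a \<Rightarrow> 'a) \<times> ('o \<Rightarrow> 'a \<Rightarrow> 'a))) set" where
  "cohomologous scale = {(x, y). x \<in> C2 scale \<and> y \<in> C2 scale \<and> x - y \<in> d1 ` C1 scale}"

definition H2 :: "('k::field \<Rightarrow> 'a \<Rightarrow> 'a) \<Rightarrow>
    (('o \<Rightarrow> 'o \<Rightarrow> 'a \<Rightarrow> 'a \<Rightarrow> 'a) \<times> ('o \<Rightarrow> 'a \<Rightarrow> 'a)) set set" where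
  "H2 scale = {x \<in> C2 scale. d2 x = 0} // cohomologous scale"

end

end

theory Submission
  imports Defs
begin

text \<open>
  Comparing the coefficients of \<open>t\<close> in the equivalence relations, evaluated at constant power
  series, gives \<open>(\<mu>\<^sub>1, N\<^sub>1) - (\<mu>'\<^sub>1, N'\<^sub>1) = d\<^sup>1 (- \<psi>\<^sub>1, 0)\<close>.
\<close>

text \<open>The equivalence relations nest one extension in another, and the coefficient of
  \<open>t\<close> in the outer one involves the inner coefficients of orders 0 and 1; hence both
  orders are computed.\<close>

lemma fam_extend_nth_0: "fps_nth (fam_extend f \<omega> x) 0 = f 0 \<omega> (fps_nth x 0)"
  by (simp add: fam_extend_def fps_extend_def)

lemma fam_extend_nth_1:
  "fps_nth (fam_extend f \<omega> x) 1 = f 0 \<omega> (fps_nth x 1) + f 1 \<omega> (fps_nth x 0)"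
  by (simp add: fam_extend_def fps_extend_def)

lemma fam_extend2_nth_0:
  "fps_nth (fam_extend2 f \<alpha> \<beta> x y) 0 = f 0 \<alpha> \<beta> (fps_nth x 0) (fps_nth y 0)"
  by (simp add: fam_extend2_def fps_extend2_def)

lemma fam_extend2_nth_1:
  "fps_nth (fam_extend2 f \<alpha> \<beta> x y) 1 =
     f 0 \<alpha> \<beta> (fps_nth x 0) (fps_nth y 1) + f 0 \<alpha> \<beta> (fps_nth x 1) (fps_nth y 0)
     + f 1 \<alpha> \<beta> (fps_nth x 0) (fps_nth y 0)"
  by (simp add: fam_extend2_def fps_extend2_def)

lemmas fam_extend_nths =
  fam_extend_nth_0 fam_extend_nth_1 fam_extend2_nth_0 fam_extend2_nth_1

lemma bilinear_map_zero:
  assumes "bilinear_map scale f"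
  shows "f a 0 = 0" "f 0 b = 0"
  using assms module_hom.zero unfolding bilinear_map_def by blast+

lemma bilinear_map_minus:
  assumes "bilinear_map scale f"
  shows "f a (- b) = - f a b" "f (- a) b = - f a b"
  using assms module_hom.neg unfolding bilinear_map_def by blast+

text \<open>\<open>cohomologous\<close> relates 2-cochains only; linearity of every coefficient is
  built into \<open>formal_deformation\<close>.\<close>

lemma infinitesimal_in_C2:
  assumes "formal_deformation scale mu N mut Nt"
  shows "infinitesimal mut Nt \<in> C2 scale"
  using assms unfolding formal_deformation_def infinitesimal_def C2_def by simp

context nijenhuis_family_algebra
begin

lemma partial0_zero: "partial0 mu N 0 \<alpha> a = 0"
  by (simp add: partial0_def bilinear_map_zero[OF bilinear_mu] module_hom.zero[OF linear_N])

text \<open>The values of \<open>f\<close> occur as arguments of \<open>mu\<close>, so bilinearity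
  is what lets the sign out.\<close>

lemma delta1_minus: "delta1 mu (- f) \<alpha> \<beta> a b = - delta1 mu f \<alpha> \<beta> a b"
  by (simp add: delta1_def bilinear_map_minus[OF bilinear_mu])

lemma Phi1_minus: "Phi1 N (- f) \<alpha> a = - Phi1 N f \<alpha> a"
  by (simp add: Phi1_def module_hom.neg[OF linear_N])

end

theorem theorem4p4:
  fixes scale :: "'k::field \<Rightarrow> 'a::ab_group_add \<Rightarrow> 'a"
    and mu :: "'o::monoid_mult \<Rightarrow> 'o \<Rightarrow> 'a \<Rightarrow> 'a \<Rightarrow> 'a"
    and N :: "'o \<Rightarrow> 'a \<Rightarrow> 'a"
    and mut mut' :: "nat \<Rightarrow> 'o \<Rightarrow> 'o \<Rightarrow> 'a \<Rightarrow> 'a \<Rightarrow> 'a"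
    and Nt Nt' :: "nat \<Rightarrow> 'o \<Rightarrow> 'a \<Rightarrow> 'a"
  assumes "vector_space scale"
    and "nijenhuis_family_algebra scale mu N"
    and "formal_deformation scale mu N mut Nt"
    and "formal_deformation scale mu N mut' Nt'"
    and "equivalent_deformations scale mut Nt mut' Nt'"
  shows "(infinitesimal mut Nt, infinitesimal mut' Nt') \<in> cohomologous mu N scale"
proof -
  interpret nijenhuis_family_algebra scale mu N by fact
  from assms(3,4) have base: "mut 0 = mu" "mut' 0 = mu" "Nt 0 = N" "Nt' 0 = N"
    and lin: "\<And>\<omega>. module_hom scale scale (Nt 1 \<omega>)"
    unfolding formal_deformation_def by auto
  from assms(5) obtain \<psi> :: "nat \<Rightarrow> 'o \<Rightarrow> 'a \<Rightarrow> 'a"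
    where hom_psi: "\<And>i \<theta>. module_hom scale scale (\<psi> i \<theta>)"
      and psi0: "\<And>\<theta>. \<psi> 0 \<theta> = id"
      and psi_mu: "\<And>\<alpha> \<beta> x y. fam_extend \<psi> (\<alpha> * \<beta>) (fam_extend2 mut' \<alpha> \<beta> x y) =
                    fam_extend2 mut \<alpha> \<beta> (fam_extend \<psi> \<alpha> x) (fam_extend \<psi> \<beta> y)"
      and psi_N: "\<And>\<omega> x. fam_extend \<psi> \<omega> (fam_extend Nt' \<omega> x) =
                    fam_extend Nt \<omega> (fam_extend \<psi> \<omega> x)"
    unfolding equivalent_deformations_def by blast
  \<comment> \<open>A constant series has coefficient 0 at \<open>t\<close>; these equations remove
    the terms in which a map is applied to it.\<close>
  have zeros: "\<psi> i \<theta> 0 = 0" "N \<theta> 0 = 0" "Nt 1 \<theta> 0 = 0"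
    "mu \<theta> \<eta> a 0 = 0" "mu \<theta> \<eta> 0 a = 0" for i \<theta> \<eta> a
    using hom_psi linear_N lin module_hom.zero bilinear_map_zero[OF bilinear_mu] by blast+
  \<comment> \<open>The sign arises because \<psi> carries the primed structure to the unprimed one,
    while the difference is taken as unprimed minus primed.\<close>
  have mu_diff: "mut 1 \<alpha> \<beta> a b - mut' 1 \<alpha> \<beta> a b = delta1 mu (- \<psi> 1) \<alpha> \<beta> a b" for \<alpha> \<beta> a b
  proof -
    have "mut' 1 \<alpha> \<beta> a b + \<psi> 1 (\<alpha> * \<beta>) (mu \<alpha> \<beta> a b) =
        mu \<alpha> \<beta> a (\<psi> 1 \<beta> b) + mu \<alpha> \<beta> (\<psi> 1 \<alpha> a) b + mut 1 \<alpha> \<beta> a b"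
      using arg_cong[OF psi_mu[of \<alpha> \<beta> "fps_const a" "fps_const b"], of "\<lambda>z. fps_nth z 1"]
      \<comment> \<open>Rewriting \<open>1\<close> to \<open>Suc 0\<close> would keep the
        coefficient rules, stated for index \<open>1\<close>, from matching.\<close>
      by (simp add: fam_extend_nths base psi0 zeros del: One_nat_def)
    then show ?thesis
      unfolding delta1_minus by (simp add: delta1_def algebra_simps)
  qed
  \<comment> \<open>The coefficient gives the commutator \<open>Phi1 N (\<psi> 1)\<close>; it is
    written with two signs so that the same 1-cochain serves both components of
    \<open>d1\<close>.\<close>
  have N_diff: "Nt 1 \<alpha> a - Nt' 1 \<alpha> a = - Phi1 N (- \<psi> 1) \<alpha> a" for \<alpha> a
  proof -
    have "Nt' 1 \<alpha> a + \<psi> 1 \<alpha> (N \<alpha> a) = N \<alpha> (\<psi> 1 \<alpha> a) + Nt 1 \<alpha> a"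
      using arg_cong[OF psi_N[of \<alpha> "fps_const a"], of "\<lambda>z. fps_nth z 1"]
      by (simp add: fam_extend_nths base psi0 zeros del: One_nat_def)
    then show ?thesis
      unfolding Phi1_minus by (simp add: Phi1_def algebra_simps)
  qed
  \<comment> \<open>Both differences are already accounted for by \<open>- \<psi> 1\<close>, so the
    element of \<open>A\<close> is chosen as 0, which makes the \<open>partial0\<close> term
    vanish.\<close>
  have "infinitesimal mut Nt - infinitesimal mut' Nt' = d1 mu N (- \<psi> 1, 0)"
    using mu_diff N_diff
    by (simp add: infinitesimal_def d1_def partial0_zero fun_eq_iff)
  moreover have "module_hom scale scale ((- \<psi> 1) \<alpha>)" for \<alpha>
    using hom_psi[of 1 \<alpha>] by (simp add: module_hom_iff)
  then have "(- \<psi> 1, 0) \<in> C1 scale"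
    by (simp add: C1_def)
  ultimately show ?thesis
    using infinitesimal_in_C2 assms(3,4) unfolding cohomologous_def by blast
qed

end
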